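(* Let $\Omega\subset\mathbb{R}^{n+m}$ be a bounded Lipschitz domain, $s\in(0,1)$, $p\in(1,\infty)$. If $u$ is an eigenfunction associated with $\lambda_1(s,p)$, then $|u|>0$ in $\Omega$.
   Context: Points of $\mathbb{R}^{n+m}$ are $(x,y)$, $x\in\mathbb{R}^n$, $y\in\mathbb{R}^m$. $[u]^p_{\mathcal W^{s,p}(\mathbb{R}^{n+m})}=\int_{\mathbb{R}^{n+m}}\int_{\mathbb{R}^n}\frac{|u(x,y)-u(z,y)|^p}{|x-z|^{n+sp}}dz\,dx\,dy+\int_{\mathbb{R}^{n+m}}\int_{\mathbb{R}^m}\frac{|u(x,y)-u(x,w)|^p}{|y-w|^{m+sp}}dw\,dx\,dy$; $\widetilde{\mathcal W}^{s,p}(\Omega)$ is the set of $u\in L^p(\mathbb{R}^{n+m})$ with finite seminorm and $u\equiv0$ outside $\Omega$. With $(a)^{p-1}=|a|^{p-2}a$, $\mathcal H_{s,p}(u,v)=\int_{\mathbb{R}^{n+m}}\int_{\mathbb{R}^n}\frac{(u(x,y)-u(z,y))^{p-1}(v(x,y)-v(z,y))}{|x-z|^{n+sp}}dz\,dx\,dy+\int_{\mathbb{R}^{n+m}}\int_{\mathbb{R}^m}\frac{(u(x,y)-u(x,w))^{p-1}(v(x,y)-v(x,w))}{|y-w|^{m+sp}}dw\,dx\,dy$. A real $\lambda$ is an eigenvalue with eigenfunction $u\in\widetilde{\mathcal W}^{s,p}(\Omega)\setminus\{0\}$ if $\mathcal H_{s,p}(u,v)=\lambda\int_\Omega(u)^{p-1}v$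 for all $v\in\widetilde{\mathcal W}^{s,p}(\Omega)$. $\lambda_1(s,p)=\inf\{[u]^p_{\mathcal W^{s,p}(\mathbb{R}^{n+m})}/\|u\|^p_{L^p(\Omega)}:u\in\widetilde{\mathcal W}^{s,p}(\Omega),u\not\equiv0\}$ is the first (smallest) eigenvalue. *)

theory Defs
  imports "HOL-Analysis.Analysis"
begin

text \<open>Points of R^(n+m) are pairs (x,y) with x :: 'a, y :: 'b, where 'a, 'b are
  Euclidean spaces of dimensions n = DIM('a), m = DIM('b).\<close>

definition lipschitz_domain :: "'c::euclidean_space set \<Rightarrow> bool" where
  "lipschitz_domain \<Omega> \<longleftrightarrow> open \<Omega> \<and> connected \<Omega> \<and> \<Omega> \<noteq> {} \<and> bounded \<Omega> \<and>
     (\<forall>z\<in>frontier \<Omega>. \<exists>r>0. \<exists>e. norm e = 1 \<and>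
        (\<exists>g L. L-lipschitz_on {v. v \<bullet> e = 0} g \<and>
           \<Omega> \<inter> ball z r = {w \<in> ball z r. (w - z) \<bullet> e > g ((w - z) - ((w - z) \<bullet> e) *\<^sub>R e)}))"

text \<open>Signed power (a)^(p-1) = |a|^(p-2) a.\<close>
definition spow :: "real \<Rightarrow> real \<Rightarrow> real" where
  "spow p a = sgn a * \<bar>a\<bar> powr (p - 1)"

definition Wsemi :: "real \<Rightarrow> real \<Rightarrow> ('a::euclidean_space \<times> 'b::euclidean_space \<Rightarrow> real) \<Rightarrow> ennreal" where
  "Wsemi s p u =
     (\<integral>\<^sup>+ ((x, y), z). ennreal (\<bar>u (x, y) - u (z, y)\<bar> powr p / norm (x - z) powr (real DIM('a) + s * p)) \<partial>lborel)
   + (\<integral>\<^sup>+ ((x, y), w). ennreal (\<bar>u (x, y) - u (x, w)\<bar> powr p / norm (y - w) powr (real DIM('b) + s * p)) \<partial>lborel)"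

text \<open>The space W~^{s,p}(Omega) (functions represented by Borel measurable representatives).\<close>
definition Wtilde :: "real \<Rightarrow> real \<Rightarrow> ('a::euclidean_space \<times> 'b::euclidean_space) set
    \<Rightarrow> ('a \<times> 'b \<Rightarrow> real) set" where
  "Wtilde s p \<Omega> = {u. u \<in> borel_measurable lborel \<and>
      (\<integral>\<^sup>+ w. ennreal (\<bar>u w\<bar> powr p) \<partial>lborel) < \<infinity> \<and>
      Wsemi s p u < \<infinity> \<and> (\<forall>w. w \<notin> \<Omega> \<longrightarrow> u w = 0)}"

definition Hsp :: "real \<Rightarrow> real \<Rightarrow> ('a::euclidean_space \<times> 'b::euclidean_space \<Rightarrow> real)
    \<Rightarrow> ('a \<times> 'b \<Rightarrow> real) \<Rightarrow> real" where
  "Hsp s p u v =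
     (\<integral> ((x, y), z). spow p (u (x, y) - u (z, y)) * (v (x, y) - v (z, y))
          / norm (x - z) powr (real DIM('a) + s * p) \<partial>lborel)
   + (\<integral> ((x, y), w). spow p (u (x, y) - u (x, w)) * (v (x, y) - v (x, w))
          / norm (y - w) powr (real DIM('b) + s * p) \<partial>lborel)"

definition eigenfunction :: "real \<Rightarrow> real \<Rightarrow> ('a::euclidean_space \<times> 'b::euclidean_space) set
    \<Rightarrow> real \<Rightarrow> ('a \<times> 'b \<Rightarrow> real) \<Rightarrow> bool" where
  "eigenfunction s p \<Omega> lam u \<longleftrightarrow> u \<in> Wtilde s p \<Omega> \<and> \<not> (AE w in lborel. u w = 0) \<and>
     (\<forall>v \<in> Wtilde s p \<Omega>. Hsp s p u v = lam * (\<integral> w. indicator \<Omega> w * (spow p (u w) * v w) \<partial>lborel))"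

definition lambda1 :: "real \<Rightarrow> real \<Rightarrow> ('a::euclidean_space \<times> 'b::euclidean_space) set \<Rightarrow> real" where
  "lambda1 s p \<Omega> = Inf {enn2real (Wsemi s p u) / enn2real (\<integral>\<^sup>+ w\<in>\<Omega>. ennreal (\<bar>u w\<bar> powr p) \<partial>lborel)
      | u. u \<in> Wtilde s p \<Omega> \<and> \<not> (AE w in lborel. u w = 0)}"

end

theory Submission
  imports Defs
begin

text \<open>
  Write \<open>v = \<bar>u\<bar>\<close> and \<open>Z = {w \<in> \<Omega>. v w = 0}\<close>. Since \<open>\<lambda>\<^sub>1 \<ge> 0\<close> and \<open>v\<close> attains the Rayleigh quotient,
  \<open>[v] \<le> [max v \<psi>]\<close> for every admissible \<open>\<psi> \<ge> 0\<close>; no Euler-Lagrange equation is needed.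
  Let \<open>\<eta>\<close> be the distance to the complement of \<open>\<Omega>\<close>. Submodularity,
  \<open>[max v \<psi>] + [min v \<psi>] \<le> [v] + [\<psi>]\<close>, with \<open>\<psi> = \<epsilon>\<eta>\<close> gives \<open>[min (v/\<epsilon>) \<eta>] \<le> [\<eta>]\<close>; letting
  \<open>\<epsilon> \<rightarrow> 0\<close>, Fatou's lemma shows that \<open>\<eta>\<close> cut off to \<open>{v > 0}\<close>, hence also \<open>\<phi>\<close>, its cut-off to \<open>Z\<close>, has
  finite energy. Now take \<open>\<psi> = t\<phi>\<close>: each pair of a point of \<open>Z\<close> and a point where \<open>v \<ge> t\<phi>\<close> lowers the
  energy of \<open>max v \<psi>\<close> by order \<open>t\<close>, while the total cost is at most \<open>t\<^sup>p[\<phi>]\<close>. As \<open>p > 1\<close>, such pairs are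
  negligible, so for almost every \<open>(x, y) \<in> Z\<close> both slices \<open>v(\<cdot>, y)\<close> and \<open>v(x, \<cdot>)\<close> vanish
  almost everywhere. Therefore on every rectangle inside \<open>\<Omega>\<close> the set \<open>Z\<close> is null or conull, and
  by connectedness this holds on \<open>\<Omega>\<close>.
\<close>

section \<open>Pointwise inequalities and abstract energies\<close>

text \<open>The triangle inequality reduces the claim to the absolute values. For two positive
  values it is \<open>powr_convex\<close>; if one of them is 0, it amounts to c^p <= c for 0 < c <
  1.\<close>

lemma convex_on_abs_powr:
  fixes p :: real
  assumes "1 \<le> p"
  shows "convex_on UNIV (\<lambda>x::real. \<bar>x\<bar> powr p)"
proof (rule convex_onI)
  fix t x y :: real
  assume t: "0 < t" "t < 1"
  define X Y where "X = \<bar>x\<bar>" and "Y = \<bar>y\<bar>"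
  have XY: "0 \<le> X" "0 \<le> Y" by (auto simp: X_def Y_def)
  have scale: "(c * z) powr p \<le> c * z powr p" if "0 < c" "c < 1" "0 \<le> z" for c z :: real
  proof -
    have "c powr p \<le> c powr 1" using that assms by (intro powr_mono') auto
    then show ?thesis using that by (simp add: powr_mult mult_right_mono)
  qed
  have "\<bar>(1 - t) *\<^sub>R x + t *\<^sub>R y\<bar> \<le> (1 - t) * X + t * Y"
    using t abs_triangle_ineq[of "(1 - t) * x" "t * y"] by (simp add: X_def Y_def abs_mult)
  then have "\<bar>(1 - t) *\<^sub>R x + t *\<^sub>R y\<bar> powr p \<le> ((1 - t) * X + t * Y) powr p"
    using assms by (intro powr_mono2) auto
  also have "\<dots> \<le> (1 - t) * X powr p + t * Y powr p"
  proof (cases "X = 0 \<or> Y = 0")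
    case True
    then show ?thesis using scale[of t Y] scale[of "1 - t" X] t XY by auto
  next
    case False
    then show ?thesis
      using convex_onD[OF powr_convex[OF assms], of t X Y] t XY by simp
  qed
  finally show "\<bar>(1 - t) *\<^sub>R x + t *\<^sub>R y\<bar> powr p \<le> (1 - t) * \<bar>x\<bar> powr p + t * \<bar>y\<bar> powr p"
    by (simp add: X_def Y_def)
qed simp

text \<open>\<open>b\<close> and \<open>c\<close> are the convex combinations of \<open>a\<close>
  and \<open>d\<close> with interchanged weights, so adding the two convexity inequalities cancels
  the weights.\<close>

lemma convex_on_spread_le:
  fixes f :: "real \<Rightarrow> real"
  assumes f: "convex_on UNIV f" and "a \<le> b" "b \<le> d" "b + c = a + d"
  shows "f b + f c \<le> f a + f d"
proof (cases "a = d")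
  case False
  define t where "t = (b - a) / (d - a)"
  have t: "0 \<le> t" "t \<le> 1" and td: "t * (d - a) = b - a"
    using assms False by (auto simp: t_def divide_simps)
  have b: "(1 - t) * a + t * d = b" using td by (simp add: algebra_simps)
  have c: "t * a + (1 - t) * d = c" using td assms(4) by (simp add: algebra_simps)
  have "f b \<le> (1 - t) * f a + t * f d" "f c \<le> t * f a + (1 - t) * f d"
    using convex_onD[OF f, of t a d] convex_onD[OF f, of "1 - t" a d] t by (simp_all add: b c)
  then show ?thesis by (simp add: algebra_simps)
qed (use assms in auto)

text \<open>Pointwise form of submodularity. If the pairs are ordered alike at both points, max and
  min only permute the terms. If they cross, the two differences on the left lie between
  \<open>a - b\<close> and \<open>c - d\<close> and have the same sum, so convexity applies.\<close>

lemma max_min_diff_powr_le: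
  fixes a b c d p :: real
  assumes p: "1 \<le> p"
  shows "\<bar>max a c - max b d\<bar> powr p + \<bar>min a c - min b d\<bar> powr p
           \<le> \<bar>a - b\<bar> powr p + \<bar>c - d\<bar> powr p"
proof -
  note spread = convex_on_spread_le[OF convex_on_abs_powr[OF p]]
  consider "a \<le> c" "b \<le> d" | "c \<le> a" "d \<le> b" | "a \<le> c" "d \<le> b" | "c \<le> a" "b \<le> d" by linarith
  then show ?thesis
  proof cases
    case 3
    then show ?thesis using spread[of "a - b" "c - b" "c - d" "a - d"] by simp
  next
    case 4
    then show ?thesis using spread[of "c - d" "a - d" "a - b" "c - b"] by simp
  qed auto
qed

text \<open>When \<open>0 < c \<le> b\<close>, disjointness of supports forces
  \<open>a = d = 0\<close>, and the saving comes from (b - c)^p <= b^(p-1) (b - c). It is linear in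
  \<open>c\<close>, whereas the cost \<open>c powr p\<close> is of higher order for p > 1. In all
  other cases the extra term is 0 and submodularity suffices.\<close>

lemma max_diff_powr_gain:
  fixes a b c d p :: real
  assumes p: "1 \<le> p" and nn: "0 \<le> a" "0 \<le> b" "0 \<le> c" "0 \<le> d"
    and disj: "c = 0 \<or> a = 0" "d = 0 \<or> b = 0"
  shows "\<bar>max a c - max b d\<bar> powr p + (if c \<le> b then b powr (p - 1) * c else 0)
           \<le> \<bar>a - b\<bar> powr p + \<bar>c - d\<bar> powr p"
proof (cases "0 < c \<and> 0 < b \<and> c \<le> b")
  case True
  then have [simp]: "a = 0" "d = 0" using disj by auto
  have "(b - c) powr p \<le> b powr (p - 1) * (b - c)"
  proof (cases "b = c")
    case False
    then have "(b - c) powr p = (b - c) powr (p - 1) * (b - c)"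
      using True by (simp add: powr_diff)
    also have "\<dots> \<le> b powr (p - 1) * (b - c)"
      using True p by (intro mult_right_mono powr_mono2) auto
    finally show ?thesis .
  qed (use True p in auto)
  also have "\<dots> = b powr p - b powr (p - 1) * c"
    using True by (simp add: powr_diff field_simps)
  finally have "(b - c) powr p + b powr (p - 1) * c \<le> b powr p" by simp
  moreover have "0 \<le> c powr p" by simp
  ultimately have "(b - c) powr p + b powr (p - 1) * c \<le> b powr p + c powr p" by linarith
  then show ?thesis using True by (simp add: abs_minus_commute[of c b])
next
  case False
  then have "(if c \<le> b then b powr (p - 1) * c else 0) = 0"
    using nn by auto
  then show ?thesis using max_min_diff_powr_le[OF p, of a c b d]
    by (simp add: add_increasing2) (smt (verit) powr_ge_zero)
qed

text \<open>\<open>S\<close> and \<open>T\<close> select the two points that are compared, and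
  \<open>k\<close> is the denominator of the kernel. Both integrals of \<open>Wsemi\<close> have
  this form, so each inequality is proved once for both directions.\<close>

definition energy :: "real \<Rightarrow> ('c::euclidean_space \<Rightarrow> 'd) \<Rightarrow> ('c \<Rightarrow> 'd) \<Rightarrow> ('c \<Rightarrow> real) \<Rightarrow> ('d \<Rightarrow> real) \<Rightarrow> ennreal"
  where "energy p S T k u = (\<integral>\<^sup>+ w. ennreal (\<bar>u (S w) - u (T w)\<bar> powr p / k w) \<partial>lborel)"

context
  fixes p :: real and S T :: "'c::euclidean_space \<Rightarrow> 'd::euclidean_space" and k :: "'c \<Rightarrow> real"
  assumes p: "1 < p"
    and S[measurable]: "S \<in> borel_measurable borel" and T[measurable]: "T \<in> borel_measurable borel"
    and k[measurable]: "k \<in> borel_measurable borel" and k_nonneg: "\<And>w. 0 \<le> k w"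
begin

lemma energy_abs_le:
  "energy p S T k (\<lambda>w. \<bar>u w\<bar>) \<le> energy p S T k u"
  unfolding energy_def using p k_nonneg
  by (intro nn_integral_mono ennreal_leI divide_right_mono powr_mono2) auto

lemma energy_scale:
  assumes [measurable]: "u \<in> borel_measurable borel"
  shows "energy p S T k (\<lambda>w. c * u w) = ennreal (\<bar>c\<bar> powr p) * energy p S T k u"
  unfolding energy_def
  by (subst nn_integral_cmult[symmetric])
     (auto intro!: nn_integral_cong
       simp flip: ennreal_mult' right_diff_distrib simp: abs_mult powr_mult)

lemma energy_diff_le:
  assumes [measurable]: "u \<in> borel_measurable borel" "v \<in> borel_measurable borel"
  shows "energy p S T k (\<lambda>w. u w - v w) \<le> ennreal (2 powr p) * (energy p S T k u + energy p S T k v)"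
proof -
  have *: "\<bar>(a - b) - (c - d)\<bar> powr p \<le> 2 powr p * (\<bar>a - c\<bar> powr p + \<bar>b - d\<bar> powr p)"
    for a b c d :: real
  proof -
    define M where "M = max \<bar>a - c\<bar> \<bar>b - d\<bar>"
    have "\<bar>(a - b) - (c - d)\<bar> powr p \<le> (2 * M) powr p"
      using p by (intro powr_mono2) (auto simp: M_def max_def abs_if)
    also have "\<dots> = 2 powr p * M powr p" by (simp add: powr_mult M_def)
    also have "M powr p \<le> \<bar>a - c\<bar> powr p + \<bar>b - d\<bar> powr p"
      by (auto simp: M_def max_def)
    finally show ?thesis by simp
  qed
  show ?thesis
    unfolding energy_def
    apply (subst nn_integral_add[symmetric], measurable)
    apply (subst nn_integral_cmult[symmetric], measurable)
    apply (intro nn_integral_mono)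
    using k_nonneg divide_right_mono[OF *]
    by (simp flip: ennreal_mult' ennreal_plus add_divide_distrib add: ennreal_leI)
qed

lemma energy_max_min:
  assumes [measurable]: "u \<in> borel_measurable borel" "v \<in> borel_measurable borel"
  shows "energy p S T k (\<lambda>w. max (u w) (v w)) + energy p S T k (\<lambda>w. min (u w) (v w))
           \<le> energy p S T k u + energy p S T k v"
  unfolding energy_def
  apply (subst (1 2) nn_integral_add[symmetric]; (measurable)?)
  apply (intro nn_integral_mono)
  using k_nonneg max_min_diff_powr_le[of p] p
  by (simp flip: ennreal_plus add_divide_distrib add: ennreal_leI divide_right_mono)

text \<open>Integrates \<open>max_diff_powr_gain\<close>. Only the pairs with \<open>v\<close> taken
  at \<open>S w\<close> and \<open>u\<close> at \<open>T w\<close> are counted; the mirrored gain is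
  discarded.\<close>

lemma energy_max_gain:
  assumes [measurable]: "u \<in> borel_measurable borel" "v \<in> borel_measurable borel"
    and nn: "\<And>w. 0 \<le> u w" "\<And>w. 0 \<le> v w" and disj: "\<And>w. v w = 0 \<or> u w = 0"
  shows "energy p S T k (\<lambda>w. max (u w) (v w))
      + (\<integral>\<^sup>+ w. ennreal ((if v (S w) \<le> u (T w) then u (T w) powr (p - 1) * v (S w) else 0) / k w) \<partial>lborel)
           \<le> energy p S T k u + energy p S T k v"
proof -
  have [measurable]: "Measurable.pred borel (\<lambda>w. v (S w) \<le> u (T w))"
    unfolding pred_def by (rule borel_measurable_le) measurable
  have "(\<lambda>w. if v (S w) \<le> u (T w) then u (T w) powr (p - 1) * v (S w) else 0) \<in> borel_measurable borel"
    by (rule measurable_If) (use borel_measurable_le in \<open>measurable\<close>)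
  then have [measurable]: "(\<lambda>w. (if v (S w) \<le> u (T w) then u (T w) powr (p - 1) * v (S w) else 0) / k w)
      \<in> borel_measurable borel"
    by (rule borel_measurable_divide) (rule k)
  have gain: "(\<lambda>w. ennreal ((if v (S w) \<le> u (T w) then u (T w) powr (p - 1) * v (S w) else 0) / k w))
      \<in> borel_measurable lborel"
    by simp
  show ?thesis
    unfolding energy_def
    apply (subst nn_integral_add[OF _ gain, symmetric], measurable)
    apply (subst nn_integral_add[symmetric], measurable)
    apply (intro nn_integral_mono)
    using k_nonneg max_diff_powr_gain[of p] p nn disj
    by (simp flip: ennreal_plus add_divide_distrib del: if_split add: ennreal_leI divide_right_mono)
qed

lemma energy_le_liminf:
  assumes [measurable]: "\<And>n::nat. f n \<in> borel_measurable borel"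
    and lim: "\<And>w. (\<lambda>n. f n w) \<longlonglongrightarrow> g w"
  shows "energy p S T k g \<le> liminf (\<lambda>n. energy p S T k (f n))"
proof -
  have "energy p S T k g = (\<integral>\<^sup>+ w. liminf (\<lambda>n. ennreal (\<bar>f n (S w) - f n (T w)\<bar> powr p / k w)) \<partial>lborel)"
    unfolding energy_def using p
    by (intro nn_integral_cong lim_imp_Liminf[symmetric] tendsto_ennrealI tendsto_divide_zero)
       (auto simp: divide_inverse intro!: tendsto_intros lim)
  also have "\<dots> \<le> liminf (\<lambda>n. energy p S T k (f n))"
    unfolding energy_def by (intro nn_integral_liminf) measurable
  finally show ?thesis .
qed

end

section \<open>Energy of Lipschitz bumps\<close>

lemma ex_dyadic_interval:
  fixes r :: real
  assumes "1 \<le> r"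
  shows "\<exists>k::nat. 2 ^ k \<le> r \<and> r < 2 ^ Suc k"
proof -
  have "nat \<lfloor>r\<rfloor> \<ge> 1" using assms by linarith
  then obtain k where k: "2 ^ k \<le> nat \<lfloor>r\<rfloor>" "nat \<lfloor>r\<rfloor> < 2 ^ Suc k"
    using ex_power_ivl1[of 2 "nat \<lfloor>r\<rfloor>"] by auto
  have "2 ^ k \<le> \<lfloor>r\<rfloor>" "\<lfloor>r\<rfloor> < 2 ^ Suc k"
    using k assms by (simp_all add: nat_less_iff le_nat_iff)
  then show ?thesis by (auto simp: le_floor_iff floor_less_iff)
qed

text \<open>The first summands form a geometric series with ratio 2^(-(1-s)p), the second ones a
  series with ratio 2^(-sp). Both ratios are below 1 because 0 < s < 1 and p > 0.\<close>

lemma dyadic_kernel_summable: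
  fixes s p M V :: real and n :: nat
  assumes s: "0 < s" "s < 1" and p: "0 < p"
  defines "\<delta> \<equiv> real n + s * p"
  shows "summable (\<lambda>k. (1 / 2 ^ k) powr p * (2 ^ Suc k) powr \<delta> * (V * (1 / 2 ^ k) ^ n)
           + M powr p / (2 ^ k) powr \<delta> * (V * (2 ^ Suc k) ^ n))"
proof -
  have pow: "(2::real) ^ j = 2 powr real j" for j by (simp add: powr_realpow)
  have "(\<lambda>k. (1 / 2 ^ k) powr p * (2 ^ Suc k) powr \<delta> * (V * (1 / 2 ^ k) ^ n)
           + M powr p / (2 ^ k) powr \<delta> * (V * (2 ^ Suc k) ^ n))
      = (\<lambda>k. V * 2 powr \<delta> * (2 powr (- ((1 - s) * p))) ^ k
           + V * M powr p * 2 ^ n * (2 powr (- (s * p))) ^ k)"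
  proof (intro ext arg_cong2[where f = "(+)"])
    fix k
    have "(1 / 2 ^ k) powr p = 2 powr (- (k * p))" "(2 ^ Suc k) powr \<delta> = 2 powr (Suc k * \<delta>)"
      "(1 / 2 ^ k :: real) ^ n = 2 powr (- (real k * n))" "(2 powr (- ((1 - s) * p))) ^ k = 2 powr (- ((1 - s) * p) * k)"
      "(2 powr (- (s * p))) ^ k = 2 powr (- (s * p) * k)" "(2 ^ Suc k :: real) ^ n = 2 powr (Suc k * n)"
      "(2 ^ k) powr \<delta> = 2 powr (k * \<delta>)" "(2::real) ^ n = 2 powr n"
      unfolding pow by (simp_all add: powr_divide powr_powr powr_minus_divide powr_power algebra_simps flip: powr_realpow)
    note e = this
    have "2 powr (- (k * p)) * 2 powr (Suc k * \<delta>) * 2 powr (- (real k * n))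
        = 2 powr \<delta> * 2 powr (- ((1 - s) * p) * k)"
      unfolding powr_add[symmetric] by (simp add: \<delta>_def algebra_simps)
    then show "(1 / 2 ^ k) powr p * (2 ^ Suc k) powr \<delta> * (V * (1 / 2 ^ k) ^ n)
        = V * 2 powr \<delta> * (2 powr (- ((1 - s) * p))) ^ k"
      unfolding e by (simp only: mult_ac)
    have "1 / 2 powr (k * \<delta>) * 2 powr (Suc k * n) = 2 powr n * 2 powr (- (s * p) * k)"
      unfolding powr_add[symmetric] powr_minus_divide[symmetric] by (simp add: \<delta>_def algebra_simps)
    then have "V * M powr p * (1 / 2 powr (k * \<delta>) * 2 powr (Suc k * n))
        = V * M powr p * (2 powr n * 2 powr (- (s * p) * k))" by (rule arg_cong)
    then show "M powr p / (2 ^ k) powr \<delta> * (V * (2 ^ Suc k) ^ n)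
        = V * M powr p * 2 ^ n * (2 powr (- (s * p))) ^ k"
      unfolding e by (simp only: divide_inverse mult_1 mult_ac)
  qed
  moreover have "summable \<dots>"
    using s p by (intro summable_add summable_mult summable_geometric) (auto simp: powr_less_one)
  ultimately show ?thesis by simp
qed

text \<open>Dyadic shells around \<open>x\<close> cover the space. With r the distance to
  \<open>x\<close>, the quotient is at most \<open>a k\<close> for 2^-(k+1) < r <= 2^-k and at most
  \<open>b k\<close> for 2^k <= r < 2^(k+1). Enlarging the shells to balls gives a convergent series
  whose value does not depend on \<open>x\<close>.\<close>

lemma truncated_kernel_integral_bounded:
  fixes s p M :: real
  assumes s: "0 < s" "s < 1" and p: "1 < p" and M: "0 \<le> M"
  obtains C where "C < \<infinity>" "\<And>x::'a::euclidean_space.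
    (\<integral>\<^sup>+ z. ennreal (min (norm (x - z)) M powr p / norm (x - z) powr (real DIM('a) + s * p)) \<partial>lborel) \<le> C"
proof
  define n where "n = DIM('a)"
  define \<delta> where "\<delta> = real n + s * p"
  define V where "V = unit_ball_vol (real n)"
  define a where "a = (\<lambda>k::nat. (1 / 2 ^ k) powr p * (2 ^ Suc k) powr \<delta>)"
  define b where "b = (\<lambda>k::nat. M powr p / (2 ^ k) powr \<delta>)"
  \<comment> \<open>The exact integral of the dominating sum of the functions \<open>F k\<close>
    below.\<close>
  define C where "C = (\<Sum>k. ennreal (a k * (V * (1 / 2 ^ k) ^ n) + b k * (V * (2 ^ Suc k) ^ n)))"
  have V: "0 \<le> V" by (simp add: V_def)
  have ab: "0 \<le> a k" "0 \<le> b k" for k by (auto simp: a_def b_def)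
  have \<delta>: "0 < \<delta>" using s p by (simp add: \<delta>_def add_nonneg_pos)
  have "summable (\<lambda>k. a k * (V * (1 / 2 ^ k) ^ n) + b k * (V * (2 ^ Suc k) ^ n))"
    unfolding a_def b_def \<delta>_def using dyadic_kernel_summable[of s p n V M] s p by simp
  then show "C < \<infinity>"
    unfolding C_def less_top[symmetric] infinity_ennreal_def using ab V by (intro ennreal_suminf_neq_top) auto
  fix x :: 'a
  define F where "F = (\<lambda>k z. ennreal (a k) * indicator (cball x (1 / 2 ^ k)) z
      + ennreal (b k) * indicator (cball x (2 ^ Suc k)) z)"
  have [measurable]: "cball x r \<in> sets borel" for r by simp
  have term_le: "F k z \<le> (\<Sum>k. F k z)" for k z
    using sum_le_suminf[of "\<lambda>k. F k z" "{k}"] by simp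
  have "(\<integral>\<^sup>+ z. ennreal (min (norm (x - z)) M powr p / norm (x - z) powr \<delta>) \<partial>lborel)
      \<le> (\<integral>\<^sup>+ z. (\<Sum>k. F k z) \<partial>lborel)"
  proof (rule nn_integral_mono)
    fix z
    define r where "r = norm (x - z)"
    have "0 \<le> r" by (simp add: r_def)
    then consider "r = 0" | "0 < r" "r \<le> 1" | "1 < r" by linarith
    then have "\<exists>k. ennreal (min r M powr p / r powr \<delta>) \<le> F k z"
    proof cases
      \<comment> \<open>On the diagonal the quotient is 0 / 0, which evaluates to 0.\<close>
      case 1
      then show ?thesis by simp
    next
      case 2
      then obtain k where k: "2 ^ k \<le> 1 / r" "1 / r < 2 ^ Suc k"
        using ex_dyadic_interval[of "1 / r"] by auto
      have rk: "r \<le> 1 / 2 ^ k" using k(1) 2 by (simp add: field_simps)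
      have "min r M powr p / r powr \<delta> = min r M powr p * (1 / r) powr \<delta>"
        using 2 by (simp add: powr_divide)
      also have "\<dots> \<le> a k"
        unfolding a_def using 2 k(2) rk M p \<delta>
        by (intro mult_mono powr_mono2) auto
      finally have "ennreal (min r M powr p / r powr \<delta>) \<le> ennreal (a k) * indicator (cball x (1 / 2 ^ k)) z"
        using rk by (simp add: r_def dist_norm ennreal_leI)
      then show ?thesis unfolding F_def by (meson add_increasing2 order_trans zero_le order_refl add_left_mono le_add_same_cancel1)
    next
      case 3
      then obtain k where k: "2 ^ k \<le> r" "r < 2 ^ Suc k"
        using ex_dyadic_interval[of r] by auto
      have "min r M powr p / r powr \<delta> \<le> b k"
        unfolding b_def using 3 k M p \<delta> by (intro frac_le powr_mono2) auto
      then have "ennreal (min r M powr p / r powr \<delta>) \<le> ennreal (b k) * indicator (cball x (2 ^ Suc k)) z"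
        using k by (simp add: r_def dist_norm ennreal_leI)
      then show ?thesis unfolding F_def by (meson add_increasing zero_le)
    qed
    then show "ennreal (min (norm (x - z)) M powr p / norm (x - z) powr \<delta>) \<le> (\<Sum>k. F k z)"
      using term_le order_trans unfolding r_def by blast
  qed
  also have "\<dots> = (\<Sum>k. \<integral>\<^sup>+ z. F k z \<partial>lborel)"
    unfolding F_def by (intro nn_integral_suminf) measurable
  also have "\<dots> = C"
    unfolding C_def
  proof (intro arg_cong[where f = suminf] ext)
    fix k
    have "(\<integral>\<^sup>+ z. F k z \<partial>lborel) = ennreal (a k) * emeasure lborel (cball x (1 / 2 ^ k))
        + ennreal (b k) * emeasure lborel (cball x (2 ^ Suc k))"
      unfolding F_def by (subst nn_integral_add) (auto simp: nn_integral_cmult_indicator)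
    also have "\<dots> = ennreal (a k * (V * (1 / 2 ^ k) ^ n) + b k * (V * (2 ^ Suc k) ^ n))"
      using ab V by (simp add: emeasure_cball n_def V_def ennreal_mult ennreal_plus del: power_Suc)
    finally show "(\<integral>\<^sup>+ z. F k z \<partial>lborel) = \<dots>" .
  qed
  finally show "(\<integral>\<^sup>+ z. ennreal (min (norm (x - z)) M powr p / norm (x - z) powr (real DIM('a) + s * p)) \<partial>lborel) \<le> C"
    by (simp add: \<delta>_def n_def)
qed

text \<open>The first and third orders put \<open>z\<close> and \<open>x\<close> innermost, as
  required to integrate the kernel with its other point fixed. The second and third differ by
  exchanging \<open>x\<close> and \<open>y\<close>, which yields the coordinate swap.\<close>

lemma nn_integral_lborel_triple:
  fixes f :: "('a::euclidean_space \<times> 'b::euclidean_space) \<times> 'c::euclidean_space \<Rightarrow> ennreal"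
  assumes [measurable]: "f \<in> borel_measurable borel"
  shows "integral\<^sup>N lborel f = (\<integral>\<^sup>+ x. \<integral>\<^sup>+ y. \<integral>\<^sup>+ z. f ((x, y), z) \<partial>lborel \<partial>lborel \<partial>lborel)"
    and "integral\<^sup>N lborel f = (\<integral>\<^sup>+ z. \<integral>\<^sup>+ x. \<integral>\<^sup>+ y. f ((x, y), z) \<partial>lborel \<partial>lborel \<partial>lborel)"
    and "integral\<^sup>N lborel f = (\<integral>\<^sup>+ z. \<integral>\<^sup>+ y. \<integral>\<^sup>+ x. f ((x, y), z) \<partial>lborel \<partial>lborel \<partial>lborel)"
proof -
  have [measurable]: "f \<in> borel_measurable ((borel \<Otimes>\<^sub>M borel) \<Otimes>\<^sub>M borel)"
    using assms by (simp add: borel_prod)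
  have 1: "integral\<^sup>N lborel f = (\<integral>\<^sup>+ w. \<integral>\<^sup>+ z. f (w, z) \<partial>lborel \<partial>lborel)"
    by (subst lborel_prod[symmetric], subst lborel.nn_integral_fst[symmetric]) (simp_all add: lborel_prod borel_prod)
  have 2: "integral\<^sup>N lborel f = (\<integral>\<^sup>+ z. \<integral>\<^sup>+ w. f (w, z) \<partial>lborel \<partial>lborel)"
    by (subst lborel_prod[symmetric], subst lborel_pair.nn_integral_snd[symmetric]) (simp_all add: lborel_prod borel_prod)
  show "integral\<^sup>N lborel f = (\<integral>\<^sup>+ x. \<integral>\<^sup>+ y. \<integral>\<^sup>+ z. f ((x, y), z) \<partial>lborel \<partial>lborel \<partial>lborel)"
    unfolding 1 by (subst lborel_prod[symmetric], subst lborel.nn_integral_fst[symmetric]) (simp_all add: lborel_prod borel_prod)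
  show "integral\<^sup>N lborel f = (\<integral>\<^sup>+ z. \<integral>\<^sup>+ x. \<integral>\<^sup>+ y. f ((x, y), z) \<partial>lborel \<partial>lborel \<partial>lborel)"
    unfolding 2 by (subst lborel_prod[symmetric], subst lborel.nn_integral_fst[symmetric]) simp_all
  show "integral\<^sup>N lborel f = (\<integral>\<^sup>+ z. \<integral>\<^sup>+ y. \<integral>\<^sup>+ x. f ((x, y), z) \<partial>lborel \<partial>lborel \<partial>lborel)"
    unfolding 2 by (subst lborel_prod[symmetric], subst lborel_pair.nn_integral_snd[symmetric]) simp_all
qed

lemma Wsemi_eq_energy:
  fixes u :: "'a::euclidean_space \<times> 'b::euclidean_space \<Rightarrow> real"
  shows "Wsemi s p u =
    energy p fst (\<lambda>w. (snd w, snd (fst w))) (\<lambda>w::('a \<times> 'b) \<times> 'a. norm (fst (fst w) - snd w) powr (real DIM('a) + s * p)) u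
  + energy p fst (\<lambda>w. (fst (fst w), snd w)) (\<lambda>w::('a \<times> 'b) \<times> 'b. norm (snd (fst w) - snd w) powr (real DIM('b) + s * p)) u"
  unfolding Wsemi_def energy_def by (simp add: case_prod_beta')

lemma Wsemi_measurable [measurable]:
  shows "(\<lambda>w::('a::euclidean_space \<times> 'b::euclidean_space) \<times> 'c::euclidean_space. (snd w, snd (fst w))) \<in> borel_measurable borel"
    "(\<lambda>w::('a::euclidean_space \<times> 'b::euclidean_space) \<times> 'c::euclidean_space. (fst (fst w), snd w)) \<in> borel_measurable borel"
    "(fst :: ('a \<times> 'b) \<times> 'c \<Rightarrow> 'a \<times> 'b) \<in> borel_measurable borel"
    "(\<lambda>w::('a \<times> 'b) \<times> 'a. norm (fst (fst w) - snd w) powr r) \<in> borel_measurable borel"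
    "(\<lambda>w::('a \<times> 'b) \<times> 'b. norm (snd (fst w) - snd w) powr r) \<in> borel_measurable borel"
  by (intro borel_measurable_continuous_onI powr_real_measurable borel_measurable_const continuous_intros)+

text \<open>The integrand is 0 unless \<open>y\<close> lies in the ball \<open>B\<close> and
  \<open>x\<close> or \<open>z\<close> lies in \<open>A\<close>. With that point of \<open>A\<close>
  fixed, the truncated kernel integrates over the other one to at most \<open>C\<close>, and the
  remaining domain has finite measure.\<close>

lemma horizontal_energy_bump_finite:
  fixes \<eta> :: "'a::euclidean_space \<times> 'b::euclidean_space \<Rightarrow> real"
  assumes s: "0 < s" "s < 1" and p: "1 < p"
    and lip: "\<And>v w. \<bar>\<eta> v - \<eta> w\<bar> \<le> dist v w"
    and bdd: "\<And>v w. \<bar>\<eta> v - \<eta> w\<bar> \<le> M"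
    and supp: "\<And>w. R < norm w \<Longrightarrow> \<eta> w = 0"
  shows "energy p fst (\<lambda>w. (snd w, snd (fst w)))
    (\<lambda>w::('a \<times> 'b) \<times> 'a. norm (fst (fst w) - snd w) powr (real DIM('a) + s * p)) \<eta> < \<infinity>"
  unfolding energy_def
proof -
  have M: "0 \<le> M" using bdd[of undefined undefined] by simp
  define A where "A = (cball 0 R :: 'a set)"
  define B where "B = (cball 0 R :: 'b set)"
  have [measurable]: "A \<in> sets borel" "B \<in> sets borel" by (simp_all add: A_def B_def)
  have fin: "emeasure lborel A < \<infinity>" "emeasure lborel B < \<infinity>"
    by (simp_all add: A_def B_def emeasure_bounded_finite[unfolded infinity_ennreal_def])
  define K where "K = (\<lambda>x z::'a. ennreal (min (norm (x - z)) M powr p / norm (x - z) powr (real DIM('a) + s * p)))"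
  obtain C where C: "C < \<infinity>" "\<And>x. (\<integral>\<^sup>+ z. K x z \<partial>lborel) \<le> C"
    using truncated_kernel_integral_bounded[OF s p M, where 'a = 'a] unfolding K_def by metis
  have C': "(\<integral>\<^sup>+ x. K x z \<partial>lborel) \<le> C" for z
    using C(2)[of z] by (simp add: K_def norm_minus_commute)
  have [measurable]: "K x \<in> borel_measurable borel" "(\<lambda>x. K x z) \<in> borel_measurable borel" for x z
    unfolding K_def by measurable
  have [measurable]: "(\<lambda>w::('a \<times> 'b) \<times> 'a. K (fst (fst w)) (snd w)) \<in> borel_measurable borel"
    unfolding K_def
    by (intro measurable_compose[OF _ measurable_ennreal] borel_measurable_divide powr_real_measurable
        borel_measurable_const borel_measurable_min borel_measurable_continuous_onI continuous_intros)
  have proj[measurable]: "(\<lambda>w::('a \<times> 'b) \<times> 'a. fst (fst w)) \<in> borel_measurable borel"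
    "(\<lambda>w::('a \<times> 'b) \<times> 'a. snd (fst w)) \<in> borel_measurable borel"
    "(\<lambda>w::('a \<times> 'b) \<times> 'a. snd w) \<in> borel_measurable borel"
    by (intro borel_measurable_continuous_onI continuous_intros)+
  have [measurable]: "(\<lambda>w::('a \<times> 'b) \<times> 'a. indicator A (fst (fst w)) :: ennreal) \<in> borel_measurable borel"
    "(\<lambda>w::('a \<times> 'b) \<times> 'a. indicator B (snd (fst w)) :: ennreal) \<in> borel_measurable borel"
    "(\<lambda>w::('a \<times> 'b) \<times> 'a. indicator A (snd w) :: ennreal) \<in> borel_measurable borel"
    by (rule measurable_compose[OF proj(1)] measurable_compose[OF proj(2)] measurable_compose[OF proj(3)], measurable)+
  have zero: "\<eta> (x, y) = 0" if "x \<notin> A \<or> y \<notin> B" for x y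
    using that supp[of "(x, y)"] norm_fst_le[of x y] norm_snd_le[of y x]
    by (auto simp: A_def B_def)
  \<comment> \<open>The Lipschitz bound controls short distances and the oscillation bound
    \<open>M\<close> long ones; together they give the truncated kernel.\<close>
  have tri: "ennreal (\<bar>\<eta> v - \<eta> w\<bar> powr p / r powr q) \<le> ennreal (min r M powr p / r powr q)"
    if "r = dist v w" for v w r q
    using that lip[of v w] bdd[of v w] p
    by (intro ennreal_leI divide_right_mono powr_mono2) auto
  have "(\<integral>\<^sup>+ w. ennreal (\<bar>\<eta> (fst w) - \<eta> (snd w, snd (fst w))\<bar> powr p / norm (fst (fst w) - snd w) powr (real DIM('a) + s * p)) \<partial>lborel)
      \<le> (\<integral>\<^sup>+ w. indicator A (fst (fst w)) * indicator B (snd (fst w)) * K (fst (fst w)) (snd w)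
              + indicator A (snd w) * indicator B (snd (fst w)) * K (fst (fst w)) (snd w) \<partial>lborel)"
  proof (intro nn_integral_mono, clarsimp)
    fix x y z
    show "ennreal (\<bar>\<eta> (x, y) - \<eta> (z, y)\<bar> powr p / norm (x - z) powr (real DIM('a) + s * p))
      \<le> indicator A x * indicator B y * K x z + indicator A z * indicator B y * K x z"
    proof (cases "(x \<in> A \<or> z \<in> A) \<and> y \<in> B")
      case True
      have "ennreal (\<bar>\<eta> (x, y) - \<eta> (z, y)\<bar> powr p / norm (x - z) powr (real DIM('a) + s * p)) \<le> K x z"
        unfolding K_def by (rule tri) (simp add: dist_Pair_Pair dist_norm)
      then show ?thesis using True by (auto simp: indicator_def intro: order_trans add_increasing)
    qed (use zero p in auto)
  qed
  also have "\<dots> = (\<integral>\<^sup>+ w. indicator A (fst (fst w)) * indicator B (snd (fst w)) * K (fst (fst w)) (snd w) \<partial>lborel)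
      + (\<integral>\<^sup>+ w. indicator A (snd w) * indicator B (snd (fst w)) * K (fst (fst w)) (snd w) \<partial>lborel)"
    by (rule nn_integral_add) measurable
  also have "(\<integral>\<^sup>+ w. indicator A (fst (fst w)) * indicator B (snd (fst w)) * K (fst (fst w)) (snd w) \<partial>lborel)
      = (\<integral>\<^sup>+ x. indicator A x * (\<integral>\<^sup>+ y. indicator B y * (\<integral>\<^sup>+ z. K x z \<partial>lborel) \<partial>lborel) \<partial>lborel)"
    by (subst nn_integral_lborel_triple(1)) (simp_all add: nn_integral_cmult mult.assoc)
  also have "\<dots> \<le> (\<integral>\<^sup>+ x. indicator A x * (\<integral>\<^sup>+ y. indicator B y * C \<partial>lborel) \<partial>(lborel::'a measure))"
    by (intro nn_integral_mono mult_left_mono C(2)) auto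
  also have "(\<integral>\<^sup>+ w. indicator A (snd w) * indicator B (snd (fst w)) * K (fst (fst w)) (snd w) \<partial>lborel)
      = (\<integral>\<^sup>+ z. indicator A z * (\<integral>\<^sup>+ y. indicator B y * (\<integral>\<^sup>+ x. K x z \<partial>lborel) \<partial>lborel) \<partial>lborel)"
    by (subst nn_integral_lborel_triple(3)) (simp_all add: nn_integral_cmult mult.assoc)
  also have "\<dots> \<le> (\<integral>\<^sup>+ z. indicator A z * (\<integral>\<^sup>+ y. indicator B y * C \<partial>lborel) \<partial>lborel)"
    by (intro nn_integral_mono mult_left_mono C') auto
  also have "(\<integral>\<^sup>+ x. indicator A x * (\<integral>\<^sup>+ y. indicator B y * C \<partial>lborel) \<partial>(lborel::'a measure))
      = emeasure lborel A * (emeasure lborel B * C)"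
    by (simp add: nn_integral_multc)
  finally show "(\<integral>\<^sup>+ w. ennreal (\<bar>\<eta> (fst w) - \<eta> (snd w, snd (fst w))\<bar> powr p
      / norm (fst (fst w) - snd w) powr (real DIM('a) + s * p)) \<partial>lborel) < \<infinity>"
    using fin C(1) by (auto simp: ennreal_mult_less_top intro: le_less_trans)
qed

lemma nn_integral_lborel_triple_swap:
  fixes f :: "('a::euclidean_space \<times> 'b::euclidean_space) \<times> 'c::euclidean_space \<Rightarrow> ennreal"
  assumes [measurable]: "f \<in> borel_measurable borel"
  shows "integral\<^sup>N lborel f = (\<integral>\<^sup>+ w. f ((snd (fst w), fst (fst w)), snd w) \<partial>lborel)"
proof -
  have "(\<lambda>w::('b \<times> 'a) \<times> 'c. ((snd (fst w), fst (fst w)), snd w)) \<in> borel_measurable borel"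
    by (intro borel_measurable_continuous_onI continuous_intros)
  then have "(\<lambda>w. f ((snd (fst w), fst (fst w)), snd w)) \<in> borel_measurable borel"
    using assms by (rule measurable_compose)
  then show ?thesis
    by (subst nn_integral_lborel_triple(2)[OF assms], subst nn_integral_lborel_triple(3)) simp_all
qed

lemma Wsemi_bump_finite:
  fixes \<eta> :: "'a::euclidean_space \<times> 'b::euclidean_space \<Rightarrow> real"
  assumes s: "0 < s" "s < 1" and p: "1 < p"
    and lip: "\<And>v w. \<bar>\<eta> v - \<eta> w\<bar> \<le> dist v w"
    and bdd: "\<And>v w. \<bar>\<eta> v - \<eta> w\<bar> \<le> M"
    and supp: "\<And>w. R < norm w \<Longrightarrow> \<eta> w = 0"
  shows "Wsemi s p \<eta> < \<infinity>"
proof -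
  have "1-lipschitz_on UNIV \<eta>"
    using lip by (intro lipschitz_onI) (auto simp: dist_real_def)
  then have [measurable]: "\<eta> \<in> borel_measurable borel"
    by (intro borel_measurable_continuous_onI lipschitz_on_continuous_on)
  have meas: "(\<lambda>w::('a \<times> 'b) \<times> 'b. ennreal (\<bar>\<eta> (fst w) - \<eta> (fst (fst w), snd w)\<bar> powr p
      / norm (snd (fst w) - snd w) powr (real DIM('b) + s * p))) \<in> borel_measurable borel"
    by measurable
  \<comment> \<open>Exchanging the two factors turns the vertical energy into the horizontal energy
    of the function with swapped arguments.\<close>
  have "energy p fst (\<lambda>w. (fst (fst w), snd w))
      (\<lambda>w::('a \<times> 'b) \<times> 'b. norm (snd (fst w) - snd w) powr (real DIM('b) + s * p)) \<eta>
    = energy p fst (\<lambda>w. (snd w, snd (fst w)))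
      (\<lambda>w::('b \<times> 'a) \<times> 'b. norm (fst (fst w) - snd w) powr (real DIM('b) + s * p)) (\<lambda>w. \<eta> (snd w, fst w))"
    unfolding energy_def
    by (subst nn_integral_lborel_triple_swap[OF meas]) simp
  also have "\<dots> < \<infinity>"
  proof (rule horizontal_energy_bump_finite[OF s p])
    show "\<bar>\<eta> (snd v, fst v) - \<eta> (snd w, fst w)\<bar> \<le> dist v w" for v w
      using lip[of "(snd v, fst v)" "(snd w, fst w)"] by (simp add: dist_prod_def add.commute)
    show "\<eta> (snd w, fst w) = 0" if "R < norm w" for w
      using supp[of "(snd w, fst w)"] that by (simp add: norm_prod_def add.commute)
  qed (rule bdd)
  finally show ?thesis
    using horizontal_energy_bump_finite[OF s p lip bdd supp] by (simp add: Wsemi_eq_energy)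
qed

section \<open>Almost-everywhere dichotomies\<close>

lemma AE_lborel_prod_iff:
  fixes P :: "'a::euclidean_space \<times> 'b::euclidean_space \<Rightarrow> bool"
  assumes P: "{w. P w} \<in> sets borel"
  shows "(AE w in lborel. P w) \<longleftrightarrow> (AE x in lborel. AE y in lborel. P (x, y))"
    and "(AE w in lborel. P w) \<longleftrightarrow> (AE y in lborel. AE x in lborel. P (x, y))"
proof -
  have meas: "{w \<in> space (lborel \<Otimes>\<^sub>M lborel). P (fst w, snd w)} \<in> sets (lborel \<Otimes>\<^sub>M (lborel :: 'b measure) :: ('a \<times> 'b) measure)"
    unfolding lborel_prod using P by simp
  show 1: "(AE w in lborel. P w) \<longleftrightarrow> (AE x in lborel. AE y in lborel. P (x, y))"
    using lborel_pair.AE_pair_iff[of "\<lambda>x y. P (x, y)", OF meas] unfolding lborel_prod by simp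
  show "(AE w in lborel. P w) \<longleftrightarrow> (AE y in lborel. AE x in lborel. P (x, y))"
    unfolding 1 using lborel_pair.AE_commute[of "\<lambda>x y. P (x, y)", OF meas] .
qed

text \<open>The exceptional set is enclosed in a Borel null set \<open>N\<close>, to which Fubini
  applies. This covers predicates that themselves contain an \<open>AE\<close>, whose measurability
  is unclear.\<close>

lemma AE_lborel_prodD:
  fixes P :: "'a::euclidean_space \<times> 'b::euclidean_space \<Rightarrow> bool"
  assumes "AE w in lborel. P w"
  shows "AE x in lborel. AE y in lborel. P (x, y)" "AE y in lborel. AE x in lborel. P (x, y)"
proof -
  obtain N where N: "N \<in> null_sets lborel" "{w. \<not> P w} \<subseteq> N"
    using assms by (auto simp: eventually_ae_filter)
  have "AE w in lborel. w \<notin> N" by (rule AE_not_in[OF N(1)])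
  moreover have "{w. w \<notin> N} \<in> sets borel"
    using N(1) by (auto simp: Collect_neg_eq dest: null_setsD2)
  ultimately have N': "AE x in lborel. AE y in lborel. (x, y) \<notin> N"
      "AE y in lborel. AE x in lborel. (x, y) \<notin> N"
    using AE_lborel_prod_iff by blast+
  have P: "P w" if "w \<notin> N" for w using N(2) that by auto
  show "AE x in lborel. AE y in lborel. P (x, y)"
    using N'(1) by (rule eventually_mono) (auto elim!: eventually_mono intro: P)
  show "AE y in lborel. AE x in lborel. P (x, y)"
    using N'(2) by (rule eventually_mono) (auto elim!: eventually_mono intro: P)
qed

lemma AE_lborel_open_imp_empty:
  fixes U :: "'c::euclidean_space set"
  assumes "open U" "AE z in lborel. z \<notin> U"
  shows "U = {}"
proof (rule ccontr)
  assume "U \<noteq> {}"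
  then obtain x e where e: "0 < e" "ball x e \<subseteq> U"
    using assms(1) by (meson ex_in_conv open_contains_ball)
  have "AE z in lborel. z \<notin> ball x e"
    using assms(2) e(2) by (auto elim!: eventually_mono)
  then have "emeasure lborel (ball x e) = 0"
    by (subst (asm) AE_iff_measurable[of "ball x e"]) auto
  then show False
    using e(1) unit_ball_vol_pos[of "real DIM('c)"] by (simp add: emeasure_ball)
qed

text \<open>Lindelof's theorem reduces the union to countably many sets, hence to countably many
  null sets.\<close>

lemma AE_Union_open:
  fixes F :: "'c::euclidean_space set set"
  assumes "\<And>U. U \<in> F \<Longrightarrow> open U" "\<And>U. U \<in> F \<Longrightarrow> AE z in lborel. z \<in> U \<longrightarrow> P z"
  shows "AE z in lborel. z \<in> \<Union>F \<longrightarrow> P z"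
proof -
  obtain F' where F': "F' \<subseteq> F" "countable F'" "\<Union>F' = \<Union>F"
    using Lindelof[of F] assms(1) by auto
  have "AE z in lborel. \<forall>U\<in>F'. z \<in> U \<longrightarrow> P z"
    using F'(1) assms(2) by (subst AE_ball_countable[OF F'(2)]) auto
  then show ?thesis
    by (rule eventually_mono) (use F'(3) in blast)
qed

text \<open>\<open>V\<close> and \<open>W\<close> are the largest open sets on which
  \<open>P\<close> holds, respectively fails, almost everywhere. Their intersection is open and
  null, hence empty, and they cover \<open>\<Omega>\<close>; connectedness puts
  \<open>\<Omega>\<close> inside one of them.\<close>

lemma AE_dichotomy_connected:
  fixes \<Omega> :: "'c::euclidean_space set"
  assumes "connected \<Omega>"
    and local: "\<And>w. w \<in> \<Omega> \<Longrightarrow> \<exists>U. open U \<and> w \<in> U \<and>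
      ((AE z in lborel. z \<in> U \<longrightarrow> P z) \<or> (AE z in lborel. z \<in> U \<longrightarrow> \<not> P z))"
  shows "(AE z in lborel. z \<in> \<Omega> \<longrightarrow> P z) \<or> (AE z in lborel. z \<in> \<Omega> \<longrightarrow> \<not> P z)"
proof -
  define F where "F = (\<lambda>Q. {U::'c set. open U \<and> (AE z in lborel. z \<in> U \<longrightarrow> Q z)})"
  define V W where "V = \<Union>(F P)" and "W = \<Union>(F (\<lambda>z. \<not> P z))"
  have op: "open V" "open W" by (auto simp: V_def W_def F_def)
  have ae: "AE z in lborel. z \<in> V \<longrightarrow> P z" "AE z in lborel. z \<in> W \<longrightarrow> \<not> P z"
    unfolding V_def W_def by (rule AE_Union_open; simp add: F_def)+
  have "AE z in lborel. z \<notin> V \<inter> W"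
    using ae by eventually_elim auto
  then have "V \<inter> W = {}" using op by (intro AE_lborel_open_imp_empty) auto
  moreover have "\<Omega> \<subseteq> V \<union> W"
    using local by (fastforce simp: V_def W_def F_def)
  ultimately have "\<Omega> \<subseteq> V \<or> \<Omega> \<subseteq> W"
    using connectedD[OF assms(1) op] by blast
  then show ?thesis
  proof
    assume "\<Omega> \<subseteq> V"
    then show ?thesis using ae(1) by (intro disjI1) (auto elim!: eventually_mono)
  next
    assume "\<Omega> \<subseteq> W"
    then show ?thesis using ae(2) by (intro disjI2) (auto elim!: eventually_mono)
  qed
qed

text \<open>If the zeros in the rectangle are not negligible, some row \<open>y\<close> contains
  non-negligibly many of them and satisfies both slice properties almost everywhere. One good zero
  makes the whole row vanish almost everywhere; the vertical property at the points of this row then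
  makes almost every column over \<open>A\<close> vanish.\<close>

lemma AE_zero_dichotomy_rectangle:
  fixes v :: "'a::euclidean_space \<times> 'b::euclidean_space \<Rightarrow> real"
  assumes v[measurable]: "v \<in> borel_measurable borel"
    and AB: "open A" "open B" "A \<times> B \<subseteq> \<Omega>"
    and horizontal: "AE w in lborel. w \<in> \<Omega> \<and> v w = 0 \<longrightarrow> (AE z in lborel. v (z, snd w) = 0)"
    and vertical: "AE w in lborel. w \<in> \<Omega> \<and> v w = 0 \<longrightarrow> (AE z in lborel. v (fst w, z) = 0)"
  shows "(AE w in lborel. w \<in> A \<times> B \<longrightarrow> v w \<noteq> 0) \<or> (AE w in lborel. w \<in> A \<times> B \<longrightarrow> \<not> v w \<noteq> 0)"
proof (rule disjCI)
  have ex: "\<exists>y. P y \<and> \<not> Q y" if "\<not> (AE y in lborel. Q y)" "AE y in lborel. P y" for P Q :: "'b \<Rightarrow> bool"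
    using that by (metis (mono_tags, lifting) eventually_mono)
  assume *: "\<not> (AE w in lborel. w \<in> A \<times> B \<longrightarrow> \<not> v w \<noteq> 0)"
  have [measurable]: "A \<times> B \<in> sets borel" using AB by (simp add: open_Times)
  have m: "{w. w \<in> A \<times> B \<longrightarrow> v w \<noteq> 0} \<in> sets borel" "{w. w \<in> A \<times> B \<longrightarrow> \<not> v w \<noteq> 0} \<in> sets borel"
    by measurable
  show "AE w in lborel. w \<in> A \<times> B \<longrightarrow> v w \<noteq> 0"
  proof (rule ccontr)
    assume "\<not> (AE w in lborel. w \<in> A \<times> B \<longrightarrow> v w \<noteq> 0)"
    then have "\<not> (AE y in lborel. AE x in lborel. (x, y) \<in> A \<times> B \<longrightarrow> v (x, y) \<noteq> 0)"
      using AE_lborel_prod_iff(2)[OF m(1)] by simp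
    moreover have "AE y in lborel. (AE x in lborel. (x, y) \<in> \<Omega> \<and> v (x, y) = 0 \<longrightarrow> (AE z in lborel. v (z, y) = 0)) \<and>
          (AE x in lborel. (x, y) \<in> \<Omega> \<and> v (x, y) = 0 \<longrightarrow> (AE z in lborel. v (x, z) = 0))"
      using AE_lborel_prodD(2)[OF horizontal] AE_lborel_prodD(2)[OF vertical]
      by eventually_elim simp
    ultimately obtain y where y: "\<not> (AE x in lborel. (x, y) \<in> A \<times> B \<longrightarrow> v (x, y) \<noteq> 0)"
      and h: "AE x in lborel. (x, y) \<in> \<Omega> \<and> v (x, y) = 0 \<longrightarrow> (AE z in lborel. v (z, y) = 0)"
      and g: "AE x in lborel. (x, y) \<in> \<Omega> \<and> v (x, y) = 0 \<longrightarrow> (AE z in lborel. v (x, z) = 0)"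
      by (blast dest: ex)
    have yB: "y \<in> B" using y by auto
    have "AE z in lborel. v (z, y) = 0"
    proof (rule ccontr)
      \<comment> \<open>Then \<open>h\<close> would leave only negligibly many zeros of row
        \<open>y\<close> in the rectangle, contrary to the choice of \<open>y\<close>.\<close>
      assume "\<not> (AE z in lborel. v (z, y) = 0)"
      with h AB(3) have "AE x in lborel. (x, y) \<in> A \<times> B \<longrightarrow> v (x, y) \<noteq> 0"
        by (auto elim!: eventually_mono)
      with y show False by simp
    qed
    with g have "AE x in lborel. x \<in> A \<longrightarrow> (AE z in lborel. v (x, z) = 0)"
      by eventually_elim (use AB(3) yB in auto)
    then have "AE x in lborel. AE z in lborel. (x, z) \<in> A \<times> B \<longrightarrow> \<not> v (x, z) \<noteq> 0"
      by (rule eventually_mono) (auto elim: eventually_mono)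
    with * AE_lborel_prod_iff(1)[OF m(2)] show False by simp
  qed
qed

section \<open>Minimality of the first eigenfunction\<close>

lemma Wsemi_abs_le: "Wsemi s p (\<lambda>w. \<bar>u w\<bar>) \<le> Wsemi s p u" if "1 < p"
  unfolding Wsemi_eq_energy using that by (intro add_mono energy_abs_le) auto

lemma Wsemi_scale:
  fixes u :: "'a::euclidean_space \<times> 'b::euclidean_space \<Rightarrow> real"
  assumes "1 < p" and [measurable]: "u \<in> borel_measurable borel"
  shows "Wsemi s p (\<lambda>w. c * u w) = ennreal (\<bar>c\<bar> powr p) * Wsemi s p u"
  using assms by (simp add: Wsemi_eq_energy energy_scale distrib_left)

lemma Wsemi_diff_le:
  fixes u v :: "'a::euclidean_space \<times> 'b::euclidean_space \<Rightarrow> real"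
  assumes "1 < p" and [measurable]: "u \<in> borel_measurable borel" "v \<in> borel_measurable borel"
  shows "Wsemi s p (\<lambda>w. u w - v w) \<le> ennreal (2 powr p) * (Wsemi s p u + Wsemi s p v)"
  unfolding Wsemi_eq_energy
  by (rule order_trans[OF add_mono[OF energy_diff_le energy_diff_le]])
     (use assms in \<open>auto simp: distrib_left algebra_simps\<close>)

lemma Wsemi_max_min:
  fixes u v :: "'a::euclidean_space \<times> 'b::euclidean_space \<Rightarrow> real"
  assumes "1 < p" and [measurable]: "u \<in> borel_measurable borel" "v \<in> borel_measurable borel"
  shows "Wsemi s p (\<lambda>w. max (u w) (v w)) + Wsemi s p (\<lambda>w. min (u w) (v w)) \<le> Wsemi s p u + Wsemi s p v"
  unfolding Wsemi_eq_energy
  by (rule order_trans[OF _ order_trans[OF add_mono[OF energy_max_min energy_max_min]]])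
     (use assms in \<open>auto simp: algebra_simps\<close>)

text \<open>Fatou's lemma is applied to the two halves of the seminorm separately, each bounded by
  \<open>C\<close>; the resulting doubled bound is enough for finiteness.\<close>

lemma Wsemi_limit_le:
  fixes f :: "nat \<Rightarrow> 'a::euclidean_space \<times> 'b::euclidean_space \<Rightarrow> real"
  assumes "1 < p" and [measurable]: "\<And>n. f n \<in> borel_measurable borel"
    and lim: "\<And>w. (\<lambda>n. f n w) \<longlonglongrightarrow> g w" and le: "\<And>n. Wsemi s p (f n) \<le> C"
  shows "Wsemi s p g \<le> C + C"
proof -
  have C: "liminf F \<le> C" if "\<And>n. F n \<le> C" for F :: "nat \<Rightarrow> ennreal"
    using Liminf_mono[of F "\<lambda>_. C" sequentially] that by (simp add: Liminf_const)
  have summand: "a \<le> C" "b \<le> C" if "a + b \<le> C" for a b :: ennreal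
    using that by (auto intro: order_trans[rotated])
  show ?thesis
    unfolding Wsemi_eq_energy
    by (intro add_mono order_trans[OF energy_le_liminf[OF _ _ _ _ _ _ lim]] C
          summand[OF le[unfolded Wsemi_eq_energy]])
       (auto simp: \<open>1 < p\<close>)
qed

text \<open>The weak equation is tested with \<open>u\<close> itself, where
  \<open>spow p a * a\<close> becomes |a|^p.\<close>

lemma eigenfunction_Wsemi:
  fixes u :: "'a::euclidean_space \<times> 'b::euclidean_space \<Rightarrow> real"
  assumes p: "1 < p" and eig: "eigenfunction s p \<Omega> lam u"
  shows "enn2real (Wsemi s p u) = lam * enn2real (\<integral>\<^sup>+ w. ennreal (\<bar>u w\<bar> powr p) \<partial>lborel)"
proof -
  have u: "u \<in> Wtilde s p \<Omega>" using eig by (simp add: eigenfunction_def)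
  then have [measurable]: "u \<in> borel_measurable borel" and zero: "\<And>w. w \<notin> \<Omega> \<Longrightarrow> u w = 0"
    and fin: "Wsemi s p u < \<infinity>"
    by (auto simp: Wtilde_def)
  have spow: "spow p a * a = \<bar>a\<bar> powr p" for a
    by (cases "a = 0") (use p in \<open>auto simp: spow_def powr_diff sgn_if abs_if\<close>)
  have int: "(LINT w|lborel. \<bar>u (S w) - u (T w)\<bar> powr p / k w) = enn2real (energy p S T k u)"
    if [measurable]: "S \<in> borel_measurable borel" "T \<in> borel_measurable borel" "k \<in> borel_measurable borel"
      and "\<And>w. 0 \<le> k w"
    for S T :: "'c::euclidean_space \<Rightarrow> _" and k
    unfolding energy_def by (rule integral_eq_nn_integral) (use that(4) in auto)
  \<comment> \<open>Finiteness of the seminorm lets \<open>enn2real\<close> distribute over its two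
    halves.\<close>
  have "enn2real (Wsemi s p u) = Hsp s p u u"
    unfolding Wsemi_eq_energy Hsp_def using fin[unfolded Wsemi_eq_energy]
    by (subst enn2real_plus; (subst (1 2) int[symmetric])?) (auto simp: spow case_prod_beta')
  also have "\<dots> = lam * (\<integral> w. indicator \<Omega> w * (spow p (u w) * u w) \<partial>lborel)"
    using eig u by (simp add: eigenfunction_def)
  also have "(\<lambda>w. indicator \<Omega> w * (spow p (u w) * u w)) = (\<lambda>w. \<bar>u w\<bar> powr p)"
    using zero by (auto simp: spow indicator_def fun_eq_iff)
  also have "(\<integral> w. \<bar>u w\<bar> powr p \<partial>lborel) = enn2real (\<integral>\<^sup>+ w. ennreal (\<bar>u w\<bar> powr p) \<partial>lborel)"
    by (rule integral_eq_nn_integral) auto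
  finally show ?thesis .
qed

text \<open>With \<open>N\<close> the p-th power of the norm, [|u|] <= [u] = \<open>lambda1\<close>
  N(u) <= \<open>lambda1\<close> N(v) <= [v]. The middle step uses that \<open>lambda1\<close> is
  nonnegative, the last one that \<open>v\<close> competes in the infimum.\<close>

lemma first_eigenfunction_abs_minimal:
  fixes u v :: "'a::euclidean_space \<times> 'b::euclidean_space \<Rightarrow> real"
  assumes p: "1 < p" and eig: "eigenfunction s p \<Omega> (lambda1 s p \<Omega>) u"
    and [measurable]: "v \<in> borel_measurable borel"
    and le: "\<And>w. \<bar>u w\<bar> \<le> v w" and zero: "\<And>w. w \<notin> \<Omega> \<Longrightarrow> v w = 0"
    and fin: "(\<integral>\<^sup>+ w. ennreal (\<bar>v w\<bar> powr p) \<partial>lborel) < \<infinity>"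
  shows "Wsemi s p (\<lambda>w. \<bar>u w\<bar>) \<le> Wsemi s p v"
proof (cases "Wsemi s p v < \<infinity>")
  case True
  define N where "N = (\<lambda>f::'a \<times> 'b \<Rightarrow> real. enn2real (\<integral>\<^sup>+ w. ennreal (\<bar>f w\<bar> powr p) \<partial>lborel))"
  define Q where "Q = {enn2real (Wsemi s p u) / enn2real (\<integral>\<^sup>+ w\<in>\<Omega>. ennreal (\<bar>u w\<bar> powr p) \<partial>lborel)
      | u. u \<in> Wtilde s p \<Omega> \<and> \<not> (AE w in lborel. u w = 0)}"
  have restrict: "(\<integral>\<^sup>+ w\<in>\<Omega>. ennreal (\<bar>f w\<bar> powr p) \<partial>lborel) = (\<integral>\<^sup>+ w. ennreal (\<bar>f w\<bar> powr p) \<partial>lborel)"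
    if "f \<in> Wtilde s p \<Omega>" for f
    using that p by (intro nn_integral_cong) (auto simp: Wtilde_def indicator_def)
  have u: "u \<in> Wtilde s p \<Omega>" "\<not> (AE w in lborel. u w = 0)"
    using eig by (auto simp: eigenfunction_def)
  then have [measurable]: "u \<in> borel_measurable borel" by (simp add: Wtilde_def)
  have v: "v \<in> Wtilde s p \<Omega>"
    using True fin zero by (simp add: Wtilde_def)
  have v0: "\<not> (AE w in lborel. v w = 0)"
  proof
    assume "AE w in lborel. v w = 0"
    then have "AE w in lborel. u w = 0"
      by (rule eventually_mono) (metis abs_le_zero_iff le)
    with u(2) show False by simp
  qed
  have "(\<integral>\<^sup>+ w. ennreal (\<bar>v w\<bar> powr p) \<partial>lborel) \<noteq> 0"
    using v0 by (subst nn_integral_0_iff_AE) (auto simp: ennreal_eq_0_iff)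
  \<comment> \<open>Finiteness of the integral matters here, since \<open>enn2real\<close> sends
    infinity to 0.\<close>
  then have Nv: "0 < N v"
    unfolding N_def enn2real_positive_iff using fin by (simp add: less_top zero_less_iff_neq_zero)
  have lam: "0 \<le> lambda1 s p \<Omega>"
    unfolding lambda1_def using u by (intro cInf_greatest) auto
  have "lambda1 s p \<Omega> \<le> enn2real (Wsemi s p v) / N v"
    unfolding lambda1_def N_def restrict[OF v, symmetric]
    by (rule cInf_lower) (use v v0 in \<open>auto intro!: bdd_belowI[of _ 0]\<close>)
  then have "lambda1 s p \<Omega> * N v \<le> enn2real (Wsemi s p v)"
    using Nv by (simp add: field_simps)
  moreover have "N u \<le> N v"
    unfolding N_def using p fin le
    by (intro enn2real_mono nn_integral_mono ennreal_leI powr_mono2)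
       (auto intro: order_trans[OF le abs_ge_self])
  ultimately have "lambda1 s p \<Omega> * N u \<le> enn2real (Wsemi s p v)"
    using lam by (meson mult_left_mono order_trans)
  then have "enn2real (Wsemi s p u) \<le> enn2real (Wsemi s p v)"
    using eigenfunction_Wsemi[OF p eig] by (simp add: N_def)
  moreover have "Wsemi s p u < \<infinity>" using u by (simp add: Wtilde_def)
  ultimately have "Wsemi s p u \<le> Wsemi s p v"
    using True by (metis ennreal_enn2real ennreal_leI infinity_ennreal_def)
  then show ?thesis using Wsemi_abs_le[OF p, of s u] by simp
qed (auto simp: not_less top_unique)

text \<open>Dividing the bound by \<open>c\<close> leaves c^(p-1) \<open>W\<close> on the right,
  which tends to 0 because p > 1. By Fatou the limit integrand v^(p-1) \<phi> / k has integral 0.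
  Where \<open>k w = 0\<close> the quotient is 0 by convention, so nothing is concluded
  there.\<close>

lemma gain_vanishes:
  fixes S T :: "'c::euclidean_space \<Rightarrow> 'd::euclidean_space" and v \<phi> :: "'d \<Rightarrow> real"
  assumes p: "1 < p"
    and [measurable]: "S \<in> borel_measurable borel" "T \<in> borel_measurable borel" "k \<in> borel_measurable borel"
      "v \<in> borel_measurable borel" "\<phi> \<in> borel_measurable borel"
    and nn: "\<And>w. 0 \<le> k w" "\<And>w. 0 \<le> v w" "\<And>w. 0 \<le> \<phi> w" and W: "W < \<infinity>"
    and le: "\<And>c. 0 < c \<Longrightarrow> c \<le> 1 \<Longrightarrow>
      (\<integral>\<^sup>+ w. ennreal ((if c * \<phi> (S w) \<le> v (T w) then v (T w) powr (p - 1) * (c * \<phi> (S w)) else 0) / k w) \<partial>lborel)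
        \<le> ennreal (c powr p) * W"
  shows "AE w in lborel. k w \<noteq> 0 \<longrightarrow> \<phi> (S w) = 0 \<or> v (T w) = 0"
proof -
  define c where "c = (\<lambda>n::nat. 1 / real (Suc n))"
  have c: "0 < c n" "c n \<le> 1" for n by (auto simp: c_def)
  have c0: "c \<longlonglongrightarrow> 0"
    unfolding c_def using LIMSEQ_inverse_real_of_nat by (simp add: inverse_eq_divide)
  \<comment> \<open>The gain integrand for \<open>c n\<close>, divided by
    \<open>c n\<close>.\<close>
  define h where "h = (\<lambda>n w. (if c n * \<phi> (S w) \<le> v (T w) then v (T w) powr (p - 1) * \<phi> (S w) else 0) / k w)"
  have h[measurable]: "h n \<in> borel_measurable borel" for n
  proof -
    have "(\<lambda>w. if c n * \<phi> (S w) \<le> v (T w) then v (T w) powr (p - 1) * \<phi> (S w) else 0) \<in> borel_measurable borel"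
      by (rule measurable_If) (use borel_measurable_le in \<open>measurable\<close>)
    then show ?thesis
      unfolding h_def by (rule borel_measurable_divide) measurable
  qed
  have bound: "(\<integral>\<^sup>+ w. ennreal (h n w) \<partial>lborel) \<le> ennreal (c n powr (p - 1)) * W" for n
  proof -
    have "(\<integral>\<^sup>+ w. ennreal (h n w) \<partial>lborel) = (\<integral>\<^sup>+ w. ennreal (1 / c n) * ennreal (c n * h n w) \<partial>lborel)"
      using c[of n] by (intro nn_integral_cong) (simp flip: ennreal_mult')
    also have "\<dots> = ennreal (1 / c n) * (\<integral>\<^sup>+ w. ennreal (c n * h n w) \<partial>lborel)"
      by (rule nn_integral_cmult) measurable
    also have "(\<integral>\<^sup>+ w. ennreal (c n * h n w) \<partial>lborel)
       = (\<integral>\<^sup>+ w. ennreal ((if c n * \<phi> (S w) \<le> v (T w) then v (T w) powr (p - 1) * (c n * \<phi> (S w)) else 0) / k w) \<partial>lborel)"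
      by (intro nn_integral_cong) (auto simp: h_def mult_ac)
    also have "\<dots> \<le> ennreal (c n powr p) * W" by (rule le) (use c in auto)
    also have "ennreal (1 / c n) * (ennreal (c n powr p) * W) = ennreal (c n powr (p - 1)) * W"
      using c[of n] by (simp add: powr_diff mult.assoc[symmetric] flip: ennreal_mult')
    finally show ?thesis by (simp add: mult_left_mono)
  qed
  have lim: "(\<lambda>n. h n w) \<longlonglongrightarrow> v (T w) powr (p - 1) * \<phi> (S w) / k w" for w
  proof (cases "v (T w) = 0")
    case False
    then have "0 < v (T w)" using nn(2)[of "T w"] by simp
    moreover have "(\<lambda>n. c n * \<phi> (S w)) \<longlonglongrightarrow> 0"
      using tendsto_mult_right[OF c0, of "\<phi> (S w)"] by simp
    \<comment> \<open>From such an index on the condition in \<open>h\<close> holds, so the sequence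
      is eventually constant.\<close>
    ultimately have "\<forall>\<^sub>F n in sequentially. c n * \<phi> (S w) < v (T w)"
      by (rule order_tendstoD(2)[rotated])
    then have "\<forall>\<^sub>F n in sequentially. h n w = v (T w) powr (p - 1) * \<phi> (S w) / k w"
      by eventually_elim (simp add: h_def)
    then show ?thesis by (rule tendsto_eventually)
  qed (simp add: h_def cong: if_cong)
  have "(\<integral>\<^sup>+ w. ennreal (v (T w) powr (p - 1) * \<phi> (S w) / k w) \<partial>lborel)
      = (\<integral>\<^sup>+ w. liminf (\<lambda>n. ennreal (h n w)) \<partial>lborel)"
    by (intro nn_integral_cong lim_imp_Liminf[symmetric] tendsto_ennrealI lim) simp
  also have "\<dots> \<le> liminf (\<lambda>n. \<integral>\<^sup>+ w. ennreal (h n w) \<partial>lborel)"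
    by (intro nn_integral_liminf) measurable
  also have "\<dots> \<le> liminf (\<lambda>n. ennreal (c n powr (p - 1)) * W)"
    by (intro Liminf_mono always_eventually allI bound)
  also have "\<dots> = 0"
  proof (rule lim_imp_Liminf)
    obtain r where r: "0 \<le> r" "W = ennreal r" using W by (cases W) auto
    have "(\<lambda>n. c n powr (p - 1)) \<longlonglongrightarrow> 0"
      using p c by (intro tendsto_zero_powrI[OF c0 tendsto_const]) (auto intro!: always_eventually less_imp_le)
    then have "(\<lambda>n. ennreal (c n powr (p - 1) * r)) \<longlonglongrightarrow> ennreal (0 * r)"
      by (intro tendsto_ennrealI tendsto_mult_right)
    then show "(\<lambda>n. ennreal (c n powr (p - 1)) * W) \<longlonglongrightarrow> 0"
      using r by (simp add: ennreal_mult')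
  qed simp
  finally have "AE w in lborel. ennreal (v (T w) powr (p - 1) * \<phi> (S w) / k w) = 0"
    by (subst (asm) le_zero_eq, subst (asm) nn_integral_0_iff_AE) auto
  then show ?thesis
  proof eventually_elim
    case (elim w)
    moreover have "0 \<le> v (T w) powr (p - 1) * \<phi> (S w) / k w"
      using nn by simp
    ultimately have "v (T w) powr (p - 1) * \<phi> (S w) / k w = 0"
      unfolding ennreal_eq_0_iff by (rule antisym)
    then show ?case by auto
  qed
qed

text \<open>Minimality makes the seminorm of the maximum at least that of \<open>u\<close>, and the
  finite seminorm of \<open>u\<close> cancels. What remains bounds the sum of both gains, hence each
  of them, by the seminorm of \<open>v\<close>.\<close>

lemma Wsemi_max_gain:
  fixes u v :: "'a::euclidean_space \<times> 'b::euclidean_space \<Rightarrow> real"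
  assumes p: "1 < p" and [measurable]: "u \<in> borel_measurable borel" "v \<in> borel_measurable borel"
    and nn: "\<And>w. 0 \<le> u w" "\<And>w. 0 \<le> v w" and disj: "\<And>w. v w = 0 \<or> u w = 0"
    and min: "Wsemi s p u \<le> Wsemi s p (\<lambda>w. max (u w) (v w))" and fin: "Wsemi s p u < \<infinity>"
  shows "(\<integral>\<^sup>+ w. ennreal ((if v (fst w) \<le> u (snd w, snd (fst w)) then u (snd w, snd (fst w)) powr (p - 1) * v (fst w) else 0)
            / norm (fst (fst w) - snd w) powr (real DIM('a) + s * p)) \<partial>lborel) \<le> Wsemi s p v" (is "?G \<le> _")
    and "(\<integral>\<^sup>+ w. ennreal ((if v (fst w) \<le> u (fst (fst w), snd w) then u (fst (fst w), snd w) powr (p - 1) * v (fst w) else 0)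
            / norm (snd (fst w) - snd w) powr (real DIM('b) + s * p)) \<partial>lborel) \<le> Wsemi s p v" (is "?H \<le> _")
proof -
  have "Wsemi s p (\<lambda>w. max (u w) (v w)) + (?G + ?H) \<le> Wsemi s p u + Wsemi s p v"
    unfolding Wsemi_eq_energy
    by (rule order_trans[OF _ order_trans[OF add_mono[OF
          energy_max_gain[OF p _ _ _ _ _ _ nn disj] energy_max_gain[OF p _ _ _ _ _ _ nn disj]]]])
       (use p in \<open>auto simp: algebra_simps\<close>)
  then have "Wsemi s p u + (?G + ?H) \<le> Wsemi s p u + Wsemi s p v"
    using min by (meson add_right_mono order_trans)
  then have "?G + ?H \<le> Wsemi s p v"
    using fin by (auto simp: ennreal_add_left_cancel_le)
  then show "?G \<le> Wsemi s p v" "?H \<le> Wsemi s p v"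
    by (auto intro: order_trans[rotated])
qed

theorem theorem3p6:
  fixes \<Omega> :: "('a::euclidean_space \<times> 'b::euclidean_space) set"
    and u :: "'a \<times> 'b \<Rightarrow> real" and s p :: real
  assumes "lipschitz_domain \<Omega>"
    and "0 < s" and "s < 1" and "1 < p"
    and "eigenfunction s p \<Omega> (lambda1 s p \<Omega>) u"
  shows "AE w in lborel. w \<in> \<Omega> \<longrightarrow> \<bar>u w\<bar> > 0"
proof -
  note s = assms(2,3) and p = assms(4) and eig = assms(5)
  have \<Omega>: "open \<Omega>" "connected \<Omega>" "bounded \<Omega>"
    using assms(1) by (simp_all add: lipschitz_domain_def)
  have [measurable]: "\<Omega> \<in> sets borel" using \<Omega>(1) by simp
  have u: "u \<in> Wtilde s p \<Omega>" "\<not> (AE w in lborel. u w = 0)"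
    using eig by (auto simp: eigenfunction_def)
  have [measurable]: "u \<in> borel_measurable borel" using u by (simp add: Wtilde_def)
  define v where "v = (\<lambda>w. \<bar>u w\<bar>)"
  have v[measurable]: "v \<in> borel_measurable borel" unfolding v_def by measurable
  have v_nn: "0 \<le> v w" for w by (simp add: v_def)
  have v_zero: "v w = 0" if "w \<notin> \<Omega>" for w using u(1) that by (cases w) (simp add: v_def Wtilde_def)
  have v_Lp: "(\<integral>\<^sup>+ w. ennreal (v w powr p) \<partial>lborel) < \<infinity>" using u(1) by (simp add: v_def Wtilde_def)
  have v_fin: "Wsemi s p v < \<infinity>"
    using u(1) Wsemi_abs_le[OF p, of s u] by (auto simp: v_def Wtilde_def intro: le_less_trans)

  \<comment> \<open>The distance bump and the admissible competitors\<close>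
  define \<eta> where "\<eta> = (\<lambda>w. infdist w (- \<Omega>))"
  obtain R where R: "0 < R" "\<And>w. w \<in> \<Omega> \<Longrightarrow> norm w \<le> R"
    using \<Omega>(3) by (auto simp: bounded_pos)
  have "\<Omega> \<noteq> UNIV" using \<Omega>(3) not_bounded_UNIV by auto
  then obtain a where a: "a \<in> - \<Omega>" by auto
  \<comment> \<open>Bounds the distance from a point of \<open>\<Omega>\<close> to the fixed outside
    point \<open>a\<close>, hence also \<open>\<eta>\<close>.\<close>
  define M where "M = R + norm a"
  have \<eta>_nn: "0 \<le> \<eta> w" for w by (simp add: \<eta>_def infdist_nonneg)
  have \<eta>_zero: "\<eta> w = 0" if "w \<notin> \<Omega>" for w using that by (simp add: \<eta>_def)
  have \<eta>_pos: "0 < \<eta> w" if "w \<in> \<Omega>" for w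
    using that \<Omega>(1) a infdist_pos_not_in_closed[of "- \<Omega>" w] by (auto simp: \<eta>_def closed_Compl)
  have \<eta>_le: "\<eta> w \<le> M" for w
  proof (cases "w \<in> \<Omega>")
    case True
    have "\<eta> w \<le> norm w + norm a"
      unfolding \<eta>_def using infdist_le[OF a, of w] norm_triangle_ineq4[of w a] by (simp add: dist_norm)
    then show ?thesis using R(2)[OF True] by (simp add: M_def)
  qed (use \<eta>_zero R in \<open>simp add: M_def\<close>)
  have \<eta>_fin: "Wsemi s p \<eta> < \<infinity>"
  proof (rule Wsemi_bump_finite[OF s p])
    show "\<bar>\<eta> v - \<eta> w\<bar> \<le> dist v w" for v w
      unfolding \<eta>_def by (rule infdist_triangle_abs)
    show "\<bar>\<eta> v - \<eta> w\<bar> \<le> M" for v w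
      using \<eta>_nn[of v] \<eta>_nn[of w] \<eta>_le[of v] \<eta>_le[of w] by linarith
    show "\<eta> w = 0" if "R < norm w" for w
      using R(2)[of w] that by (intro \<eta>_zero) auto
  qed
  have \<eta>[measurable]: "\<eta> \<in> borel_measurable borel"
    unfolding \<eta>_def by (intro borel_measurable_continuous_onI continuous_on_infdist continuous_on_id)
  have \<eta>_Lp: "(\<integral>\<^sup>+ w. ennreal (\<eta> w powr p) \<partial>lborel) < \<infinity>"
  proof -
    have "(\<integral>\<^sup>+ w. ennreal (\<eta> w powr p) \<partial>lborel) \<le> (\<integral>\<^sup>+ w. ennreal (M powr p) * indicator \<Omega> w \<partial>lborel)"
      using p \<eta>_zero \<eta>_nn \<eta>_le
      by (intro nn_integral_mono) (auto simp: indicator_def intro!: ennreal_leI powr_mono2)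
    also have "\<dots> = ennreal (M powr p) * emeasure lborel \<Omega>"
      by (simp add: nn_integral_cmult_indicator)
    also have "\<dots> < \<infinity>"
      using emeasure_bounded_finite[OF \<Omega>(3)] by (simp add: ennreal_mult_less_top)
    finally show ?thesis .
  qed
  \<comment> \<open>Domination by \<open>\<eta>\<close> makes \<open>\<psi>\<close> vanish outside
    \<open>\<Omega>\<close> and keeps the maximum in L^p.\<close>
  have minimal: "Wsemi s p v \<le> Wsemi s p (\<lambda>w. max (v w) (\<psi> w))"
    if [measurable]: "\<psi> \<in> borel_measurable borel" and \<psi>: "\<And>w. 0 \<le> \<psi> w" "\<And>w. \<psi> w \<le> \<eta> w" for \<psi>
    unfolding v_def
  proof (rule first_eigenfunction_abs_minimal[OF p eig])
    show "max \<bar>u w\<bar> (\<psi> w) = 0" if "w \<notin> \<Omega>" for w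
      using v_zero[OF that] \<psi>[of w] \<eta>_zero[OF that] by (simp add: v_def)
    have "(\<integral>\<^sup>+ w. ennreal (\<bar>max \<bar>u w\<bar> (\<psi> w)\<bar> powr p) \<partial>lborel)
        \<le> (\<integral>\<^sup>+ w. ennreal (v w powr p) + ennreal (\<eta> w powr p) \<partial>lborel)"
    proof (rule nn_integral_mono)
      fix w
      have "\<bar>max \<bar>u w\<bar> (\<psi> w)\<bar> powr p \<le> v w powr p + \<eta> w powr p"
        using powr_mono2[of p "\<psi> w" "\<eta> w"] \<psi>[of w] p by (auto simp: v_def max_def add_increasing)
      then show "ennreal (\<bar>max \<bar>u w\<bar> (\<psi> w)\<bar> powr p) \<le> ennreal (v w powr p) + ennreal (\<eta> w powr p)"
        by (simp add: ennreal_leI flip: ennreal_plus)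
    qed
    also have "\<dots> < \<infinity>"
      using v_Lp \<eta>_Lp by (subst nn_integral_add) auto
    finally show "(\<integral>\<^sup>+ w. ennreal (\<bar>max \<bar>u w\<bar> (\<psi> w)\<bar> powr p) \<partial>lborel) < \<infinity>" .
  qed auto

  \<comment> \<open>Finite energy of the bump cut off to the zero set\<close>
  define g where "g = (\<lambda>w. if 0 < v w then \<eta> w else 0)"
  \<comment> \<open>Since \<open>\<eta>\<close> is 0 off \<open>\<Omega>\<close>, this is
    \<open>\<eta>\<close> on the zeros of \<open>v\<close> in \<open>\<Omega>\<close> and 0
    elsewhere.\<close>
  define \<phi> where "\<phi> = (\<lambda>w. \<eta> w - g w)"
  have g[measurable]: "g \<in> borel_measurable borel"
    unfolding g_def by measurable
  have \<phi>[measurable]: "\<phi> \<in> borel_measurable borel"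
    unfolding \<phi>_def by measurable
  have \<phi>_bounds: "0 \<le> \<phi> w" "\<phi> w \<le> \<eta> w" for w
    using \<eta>_nn[of w] by (auto simp: \<phi>_def g_def)
  \<comment> \<open>The function is the minimum of \<open>(n + 1) * v\<close> and
    \<open>\<eta>\<close>. Minimality and submodularity bound the energy of the unscaled minimum by
    c^p [\<eta>], and rescaling by 1/c removes the factor.\<close>
  have truncated: "Wsemi s p (\<lambda>w. real (Suc n) * min (v w) (1 / real (Suc n) * \<eta> w)) \<le> Wsemi s p \<eta>" for n
  proof -
    define c where "c = 1 / real (Suc n)"
    have c: "0 < c" "c \<le> 1" "real (Suc n) = 1 / c" by (simp_all add: c_def)
    have "Wsemi s p v \<le> Wsemi s p (\<lambda>w. max (v w) (c * \<eta> w))"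
      using c \<eta>_nn by (intro minimal) (auto intro: mult_left_le_one_le)
    moreover have "Wsemi s p (\<lambda>w. max (v w) (c * \<eta> w)) + Wsemi s p (\<lambda>w. min (v w) (c * \<eta> w))
        \<le> Wsemi s p v + Wsemi s p (\<lambda>w. c * \<eta> w)"
      by (rule Wsemi_max_min[OF p]) measurable
    ultimately have "Wsemi s p v + Wsemi s p (\<lambda>w. min (v w) (c * \<eta> w)) \<le> Wsemi s p v + Wsemi s p (\<lambda>w. c * \<eta> w)"
      by (meson add_right_mono order_trans)
    then have "Wsemi s p (\<lambda>w. min (v w) (c * \<eta> w)) \<le> ennreal (c powr p) * Wsemi s p \<eta>"
      using v_fin c Wsemi_scale[OF p \<eta>, of s c] by (auto simp: ennreal_add_left_cancel_le)
    then have "ennreal ((1 / c) powr p) * Wsemi s p (\<lambda>w. min (v w) (c * \<eta> w))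
        \<le> ennreal ((1 / c) powr p) * (ennreal (c powr p) * Wsemi s p \<eta>)"
      by (rule mult_left_mono) simp
    also have "\<dots> = Wsemi s p \<eta>"
      using c by (simp add: mult.assoc[symmetric] powr_divide flip: ennreal_mult')
    also have "ennreal ((1 / c) powr p) * Wsemi s p (\<lambda>w. min (v w) (c * \<eta> w))
        = Wsemi s p (\<lambda>w. (1 / c) * min (v w) (c * \<eta> w))"
      using c Wsemi_scale[OF p, of "\<lambda>w. min (v w) (c * \<eta> w)" s "1 / c"] by simp
    finally show ?thesis unfolding c(3)[symmetric] c_def by simp
  qed
  have "Wsemi s p g \<le> Wsemi s p \<eta> + Wsemi s p \<eta>"
  proof (rule Wsemi_limit_le[OF p _ _ truncated])
    fix w
    show "(\<lambda>n. real (Suc n) * min (v w) (1 / real (Suc n) * \<eta> w)) \<longlonglongrightarrow> g w"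
    proof (cases "v w = 0")
      case True
      then show ?thesis using \<eta>_nn[of w] by (simp add: g_def)
    next
      case False
      then have "0 < v w" using v_nn[of w] by simp
      \<comment> \<open>From \<open>N\<close> on, \<open>\<eta> w\<close> is the smaller argument,
        so the truncation already equals \<open>g w\<close>.\<close>
      obtain N where N: "\<eta> w / v w < real N" using reals_Archimedean2 by blast
      have "real (Suc n) * min (v w) (1 / real (Suc n) * \<eta> w) = g w" if "N \<le> n" for n
      proof -
        have "\<eta> w \<le> real (Suc n) * v w"
          using N that \<open>0 < v w\<close> by (simp add: divide_less_eq) (smt (verit) mult_right_mono of_nat_mono)
        then have "1 / real (Suc n) * \<eta> w \<le> v w" by (simp add: field_simps)
        then show ?thesis using \<open>0 < v w\<close> by (simp add: g_def min_absorb2)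
      qed
      then show ?thesis by (intro tendsto_eventually eventually_sequentiallyI)
    qed
  qed measurable
  then have "Wsemi s p g < \<infinity>" using \<eta>_fin by (simp add: le_less_trans)
  then have \<phi>_fin: "Wsemi s p \<phi> < \<infinity>"
    using Wsemi_diff_le[OF p \<eta> g, of s] \<eta>_fin
    unfolding \<phi>_def by (auto simp: ennreal_mult_less_top intro: le_less_trans)

  \<comment> \<open>Comparison with small multiples of the cut-off bump\<close>
  have disj: "c * \<phi> w = 0 \<or> v w = 0" for c w
    using v_nn[of w] by (auto simp: \<phi>_def g_def)
  have scaled: "Wsemi s p v \<le> Wsemi s p (\<lambda>w. max (v w) (c * \<phi> w))" if "0 < c" "c \<le> 1" for c
    using that \<phi>_bounds \<eta>_nn
    by (intro minimal) (auto intro: order_trans[OF mult_left_le_one_le])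
  have gains:
    "(\<integral>\<^sup>+ w. ennreal ((if c * \<phi> (fst w) \<le> v (snd w, snd (fst w)) then v (snd w, snd (fst w)) powr (p - 1) * (c * \<phi> (fst w)) else 0)
            / norm (fst (fst w) - snd w) powr (real DIM('a) + s * p)) \<partial>lborel) \<le> ennreal (c powr p) * Wsemi s p \<phi>" (is "?G \<le> _")
    "(\<integral>\<^sup>+ w. ennreal ((if c * \<phi> (fst w) \<le> v (fst (fst w), snd w) then v (fst (fst w), snd w) powr (p - 1) * (c * \<phi> (fst w)) else 0)
            / norm (snd (fst w) - snd w) powr (real DIM('b) + s * p)) \<partial>lborel) \<le> ennreal (c powr p) * Wsemi s p \<phi>" (is "?H \<le> _")
    if c: "0 < c" "c \<le> 1" for c
  proof -
    have c_eq: "ennreal (c powr p) * Wsemi s p \<phi> = Wsemi s p (\<lambda>w. c * \<phi> w)"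
      using c Wsemi_scale[OF p \<phi>, of s c] by simp
    have "(\<lambda>w. c * \<phi> w) \<in> borel_measurable borel" "\<And>w. 0 \<le> c * \<phi> w"
      using c \<phi>_bounds by auto
    from Wsemi_max_gain[OF p v this(1) v_nn this(2) disj scaled[OF c] v_fin, folded c_eq]
    show "?G \<le> ennreal (c powr p) * Wsemi s p \<phi>" "?H \<le> ennreal (c powr p) * Wsemi s p \<phi>" .
  qed
  have \<phi>_pos: "\<phi> w \<noteq> 0" if "w \<in> \<Omega>" "v w = 0" for w
    using \<eta>_pos[OF that(1)] that(2) by (simp add: \<phi>_def g_def)

  \<comment> \<open>Slices through zeros vanish almost everywhere\<close>
  have "AE w in (lborel :: (('a \<times> 'b) \<times> 'a) measure). norm (fst (fst w) - snd w) powr (real DIM('a) + s * p) \<noteq> 0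
      \<longrightarrow> \<phi> (fst w) = 0 \<or> v (snd w, snd (fst w)) = 0"
    by (rule gain_vanishes[OF p _ _ _ v \<phi> _ v_nn \<phi>_bounds(1) \<phi>_fin gains(1)]) auto
  from AE_lborel_prodD(1)[OF this]
  have horizontal: "AE w in lborel. w \<in> \<Omega> \<and> v w = 0 \<longrightarrow> (AE z in lborel. v (z, snd w) = 0)"
  proof eventually_elim
    case (elim w)
    show ?case
    proof
      assume w: "w \<in> \<Omega> \<and> v w = 0"
      \<comment> \<open>\<open>\<phi>\<close> is nonzero at \<open>w\<close>, and the kernel
        denominator vanishes only at the single point \<open>z = fst w\<close>.\<close>
      show "AE z in lborel. v (z, snd w) = 0"
        using elim AE_lborel_singleton[of "fst w"] by eventually_elim (use w \<phi>_pos in auto)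
    qed
  qed
  have "AE w in (lborel :: (('a \<times> 'b) \<times> 'b) measure). norm (snd (fst w) - snd w) powr (real DIM('b) + s * p) \<noteq> 0
      \<longrightarrow> \<phi> (fst w) = 0 \<or> v (fst (fst w), snd w) = 0"
    by (rule gain_vanishes[OF p _ _ _ v \<phi> _ v_nn \<phi>_bounds(1) \<phi>_fin gains(2)]) auto
  from AE_lborel_prodD(1)[OF this]
  have vertical: "AE w in lborel. w \<in> \<Omega> \<and> v w = 0 \<longrightarrow> (AE z in lborel. v (fst w, z) = 0)"
  proof eventually_elim
    case (elim w)
    show ?case
    proof
      assume w: "w \<in> \<Omega> \<and> v w = 0"
      show "AE z in lborel. v (fst w, z) = 0"
        using elim AE_lborel_singleton[of "snd w"] by eventually_elim (use w \<phi>_pos in auto)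
    qed
  qed

  \<comment> \<open>From local rectangles to the whole domain\<close>
  have "(AE w in lborel. w \<in> \<Omega> \<longrightarrow> v w \<noteq> 0) \<or> (AE w in lborel. w \<in> \<Omega> \<longrightarrow> \<not> v w \<noteq> 0)"
  proof (rule AE_dichotomy_connected[OF \<Omega>(2)])
    fix w assume "w \<in> \<Omega>"
    with \<Omega>(1) obtain A B where AB: "open A" "open B" "w \<in> A \<times> B" "A \<times> B \<subseteq> \<Omega>"
      by (rule open_prod_elim)
    then show "\<exists>U. open U \<and> w \<in> U \<and> ((AE z in lborel. z \<in> U \<longrightarrow> v z \<noteq> 0) \<or> (AE z in lborel. z \<in> U \<longrightarrow> \<not> v z \<noteq> 0))"
      using AE_zero_dichotomy_rectangle[OF v AB(1,2,4) horizontal vertical] open_Times by blast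
  qed
  then show ?thesis
  proof
    assume "AE w in lborel. w \<in> \<Omega> \<longrightarrow> v w \<noteq> 0"
    then show ?thesis by eventually_elim (auto simp: v_def)
  next
    assume "AE w in lborel. w \<in> \<Omega> \<longrightarrow> \<not> v w \<noteq> 0"
    \<comment> \<open>Together with the zero values outside \<open>\<Omega>\<close> this would make
      the eigenfunction trivial.\<close>
    then have "AE w in lborel. u w = 0"
      by eventually_elim (use v_zero in \<open>auto simp: v_def\<close>)
    with u(2) show ?thesis by simp
  qed
qed

end
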